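(* Let $G \in ER(n,d,4)$ have a uniform shared neighborhood structure. Then this uniform shared neighborhood structure is not isomorphic to the path $P_4$.
   Context: For a finite simple graph $G$, $N(u)$ is the open neighborhood of a vertex $u$. $G \in ER(n,d,\lambda)$ means $G$ has $n$ vertices, is $d$-regular, and every pair of adjacent vertices has exactly $\lambda$ common neighbors. $G$ has a uniform shared neighborhood structure isomorphic to $H$ if the induced subgraph $G[N(u)\cap N(v)]$ is isomorphic to $H$ for all adjacent $u,v$. $P_m$ is the path graph on $m$ vertices. *)

theory Defs
  imports "Graph_Theory.Graph_Theory"
begin

text \<open>
  Finite simple graphs are the symmetric, loop-free digraphs without parallel arcs of the locale
  \<^locale>\<open>graph\<close>: an edge $uv$ is the pair of arcs $(u,v)$, $(v,u)$, so \<^const>\<open>out_degree\<close> is the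
  ordinary degree and \<^const>\<open>digraph_iso\<close> is graph isomorphism.
\<close>

definition open_nbhd :: "('a,'b) pre_digraph \<Rightarrow> 'a \<Rightarrow> 'a set" where
  "open_nbhd G u = {v. u \<rightarrow>\<^bsub>G\<^esub> v}"

text \<open>As usual for this notation, the edgeless graphs belong to \<open>ER n 0 l\<close> for every \<open>l\<close>.\<close>

definition ER :: "nat \<Rightarrow> nat \<Rightarrow> nat \<Rightarrow> ('a,'b) pre_digraph set" where
  "ER n d l = {G. graph G \<and> card (verts G) = n \<and>
     (\<forall>v \<in> verts G. out_degree G v = d) \<and>
     (\<forall>u v. u \<rightarrow>\<^bsub>G\<^esub> v \<longrightarrow> card (open_nbhd G u \<inter> open_nbhd G v) = l)}"

definition uniform_shared_nbhd :: "('a,'b) pre_digraph \<Rightarrow> ('c,'d) pre_digraph \<Rightarrow> bool" where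
  "uniform_shared_nbhd G H \<longleftrightarrow>
     (\<forall>u v. u \<rightarrow>\<^bsub>G\<^esub> v \<longrightarrow> digraph_iso (G \<restriction> (open_nbhd G u \<inter> open_nbhd G v)) H)"

definition path_graph :: "nat \<Rightarrow> (nat, nat \<times> nat) pre_digraph" where
  "path_graph m = with_proj \<lparr> pverts = {..<m},
     parcs = {(i, j). i < m \<and> j < m \<and> (j = Suc i \<or> i = Suc j)} \<rparr>"

lemma graph_path_graph: "graph (path_graph m)"
proof -
  let ?P = "\<lparr> pverts = {..<m}, parcs = {(i, j). i < m \<and> j < m \<and> (j = Suc i \<or> i = Suc j)} \<rparr>"
  have "finite (parcs ?P)"
    by (rule finite_subset[of _ "{..<m} \<times> {..<m}"]) auto
  then have "pair_graph ?P"
    by unfold_locales (auto simp: symmetric_def intro: symI)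
  then show ?thesis
    unfolding path_graph_def by (rule pair_graph.pair_graphD_graph)
qed

end

theory Submission
  imports Defs
begin

text \<open>
  Call a triangle outer if its vertices have exactly one common neighbour, that is, if each vertex
  is an end of the path shared by the other two. Two outer triangles never share an edge inside a
  \<open>K\<^sub>4\<close>, because the ends of a \<open>P\<^sub>4\<close> are not adjacent. So in a \<open>K\<^sub>4\<close> containing an outer triangle
  \<open>uva\<close>, the three triangles at the fourth vertex \<open>b\<close> are not outer. If \<open>c\<close> is the further common
  neighbour of \<open>u, v, b\<close>, then \<open>buc\<close> and \<open>bvc\<close> are both outer, as a \<open>P\<^sub>4\<close> has only two inner
  vertices; but they share the edge \<open>bc\<close> inside the \<open>K\<^sub>4\<close> on \<open>b, u, v, c\<close>.
\<close>

text \<open>Stated for a bare relation, so that the combinatorics is free of arcs. Each pair is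
  listed in one direction only; symmetry of \<open>E\<close> supplies the other.\<close>

definition induces_P4 :: "('a \<Rightarrow> 'a \<Rightarrow> bool) \<Rightarrow> 'a set \<Rightarrow> bool" where
  "induces_P4 E S \<longleftrightarrow> (\<exists>p q r s. S = {p, q, r, s} \<and> distinct [p, q, r, s] \<and>
     E p q \<and> E q r \<and> E r s \<and> \<not> E p r \<and> \<not> E p s \<and> \<not> E q s)"

text \<open>Only \<open>q\<close> and \<open>r\<close> are inner, so three vertices always include
  an end of the path.\<close>

lemma induces_P4_at_most_two_inner:
  assumes "symp E" "irreflp E" "induces_P4 E S" "distinct [x, y, z]" "{x, y, z} \<subseteq> S"
  shows "\<exists>w \<in> {x, y, z}. \<forall>t \<in> S. \<forall>t' \<in> S. E w t \<and> E w t' \<longrightarrow> t = t'"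
proof -
  obtain p q r s where S: "S = {p, q, r, s}"
    and E: "\<not> E p r" "\<not> E p s" "\<not> E q s"
    using assms(3) unfolding induces_P4_def by blast
  have E': "\<not> E r p" "\<not> E s p" "\<not> E s q"
    using E assms(1) by (auto dest: sympD)
  have irr: "\<not> E t t" for t using assms(2) by (simp add: irreflp_def)
  have "p \<in> {x, y, z} \<or> s \<in> {x, y, z}" using assms(4,5) S by auto
  moreover have "\<forall>t \<in> S. E p t \<longrightarrow> t = q" "\<forall>t \<in> S. E s t \<longrightarrow> t = r"
    using S E E' irr by auto
  ultimately show ?thesis by metis
qed

text \<open>Every edge of the path touches an inner vertex, and that vertex lies on a second
  edge.\<close>

lemma induces_P4_no_isolated_edge:
  assumes "symp E" "irreflp E" "induces_P4 E S" "x \<in> S" "y \<in> S" "E x y"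
  shows "\<exists>z \<in> S. (z \<noteq> y \<and> E x z) \<or> (z \<noteq> x \<and> E y z)"
proof -
  obtain p q r s where S: "S = {p, q, r, s}" "distinct [p, q, r, s]"
    and E: "E p q" "E q r" "E r s" "\<not> E p r" "\<not> E p s" "\<not> E q s"
    using assms(3) unfolding induces_P4_def by blast
  have E': "E q p" "E r q" "E s r" "\<not> E r p" "\<not> E s p" "\<not> E s q"
    using E assms(1) by (auto dest: sympD)
  have irr: "\<not> E t t" for t using assms(2) by (simp add: irreflp_def)
  have "x \<in> {q, r} \<or> y \<in> {q, r}" using assms(4-6) S E E' irr by auto
  then show ?thesis using S E E' by auto
qed

lemma no_uniform_shared_P4:
  assumes sym: "symp E" and irr: "irreflp E"
    and P4: "\<And>u v. E u v \<Longrightarrow> induces_P4 E {x. E u x \<and> E v x}"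
  shows "\<not> E u v"
proof
  note inner = induces_P4_at_most_two_inner[OF sym irr P4]
  note no_isolated = induces_P4_no_isolated_edge[OF sym irr P4]
  have E_sym: "E y x" if "E x y" for x y using sym that by (rule sympD)
  have E_irr: "\<not> E x x" for x using irr by (simp add: irreflp_def)
  assume uv: "E u v"
  then obtain a b c d where S: "{x. E u x \<and> E v x} = {a, b, c, d}" and dist: "distinct [a, b, c, d]"
    and E: "E a b" "E b c" "E c d" "\<not> E a c" "\<not> E a d" "\<not> E b d"
    using P4[OF uv] unfolding induces_P4_def by blast
  have adj: "E u a" "E v a" "E u b" "E v b" "E u c" "E v c" using S by blast+
  \<comment> \<open>The end \<open>a\<close> of the path makes \<open>u v a\<close> an outer
    triangle.\<close>
  have a_end: "x = b" if "E u x" "E v x" "E a x" for x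
  proof -
    have "x \<in> {a, b, c, d}" using S that by blast
    then show ?thesis using that E E_irr by blast
  qed
  have adj': "E v u" "E a u" "E a v" "E b u" "E b v" "E c u" "E c v"
    using uv adj by (simp_all add: E_sym)
  \<comment> \<open>On the path shared by \<open>u\<close> and \<open>a\<close>,
    \<open>a_end\<close> leaves \<open>v\<close> no neighbour but \<open>b\<close>, so the second
    edge next to \<open>v b\<close> must start at \<open>b\<close>.\<close>
  have "\<exists>z \<in> {x. E u x \<and> E a x}. (z \<noteq> b \<and> E v z) \<or> (z \<noteq> v \<and> E b z)"
    by (rule no_isolated) (use uv adj E adj' in simp_all)
  then obtain p where p: "E u p" "E a p" "E b p" "p \<noteq> v"
    using a_end by blast
  have "\<exists>z \<in> {x. E v x \<and> E a x}. (z \<noteq> b \<and> E u z) \<or> (z \<noteq> u \<and> E b z)"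
    by (rule no_isolated) (use uv adj E adj' in simp_all)
  then obtain q where q: "E v q" "E a q" "E b q" "q \<noteq> u"
    using a_end by blast
  have neq: "c \<noteq> v" "v \<noteq> a" "c \<noteq> a" "c \<noteq> u" "u \<noteq> a" "u \<noteq> v"
    using adj E E_irr uv dist by auto
  have c_end_u: "x = v" if x: "E b x" "E u x" "E c x" for x
  proof -
    let ?S = "{x. E b x \<and> E u x}"
    have in_S: "c \<in> ?S" "v \<in> ?S" "a \<in> ?S" "p \<in> ?S" "x \<in> ?S"
      using x uv adj adj' E p E_sym[OF E(1)] by simp_all
    have "\<exists>w \<in> {c, v, a}. \<forall>t \<in> ?S. \<forall>t' \<in> ?S. E w t \<and> E w t' \<longrightarrow> t = t'"
    proof (rule inner)
      show "E b u" by (fact adj')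
      show "distinct [c, v, a]" using neq by simp
      show "{c, v, a} \<subseteq> ?S" using in_S by blast
    qed
    then obtain w where w: "w \<in> {c, v, a}"
        "\<And>t t'. t \<in> ?S \<Longrightarrow> t' \<in> ?S \<Longrightarrow> E w t \<Longrightarrow> E w t' \<Longrightarrow> t = t'"
      by blast
    \<comment> \<open>On the path shared by \<open>b\<close> and \<open>u\<close>, both
      \<open>v\<close> (next to \<open>c\<close> and \<open>a\<close>) and \<open>a\<close> (next to
      \<open>v\<close> and \<open>p\<close>) are inner, which forces \<open>c\<close> to be the
      end.\<close>
    have "w \<noteq> v" using w(2)[of c a] in_S neq adj by blast
    moreover have "w \<noteq> a" using w(2)[of v p] in_S p adj' by blast
    ultimately have "w = c" using w(1) by blast
    then show ?thesis using w(2)[of x v] in_S x adj' by blast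
  qed
  \<comment> \<open>The mirror image: \<open>u\<close> and \<open>v\<close> change places, and
    \<open>q\<close> replaces \<open>p\<close>.\<close>
  have c_end_v: "x = u" if x: "E b x" "E v x" "E c x" for x
  proof -
    let ?S = "{x. E b x \<and> E v x}"
    have in_S: "c \<in> ?S" "u \<in> ?S" "a \<in> ?S" "q \<in> ?S" "x \<in> ?S"
      using x uv adj adj' E q E_sym[OF E(1)] by simp_all
    have "\<exists>w \<in> {c, u, a}. \<forall>t \<in> ?S. \<forall>t' \<in> ?S. E w t \<and> E w t' \<longrightarrow> t = t'"
    proof (rule inner)
      show "E b v" by (fact adj')
      show "distinct [c, u, a]" using neq by simp
      show "{c, u, a} \<subseteq> ?S" using in_S by blast
    qed
    then obtain w where w: "w \<in> {c, u, a}"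
        "\<And>t t'. t \<in> ?S \<Longrightarrow> t' \<in> ?S \<Longrightarrow> E w t \<Longrightarrow> E w t' \<Longrightarrow> t = t'"
      by blast
    have "w \<noteq> u" using w(2)[of c a] in_S neq adj by blast
    moreover have "w \<noteq> a" using w(2)[of u q] in_S q adj' by blast
    ultimately have "w = c" using w(1) by blast
    then show ?thesis using w(2)[of x u] in_S x adj' by blast
  qed
  \<comment> \<open>The edge \<open>u v\<close> lies on the path shared by \<open>b\<close> and
    \<open>c\<close>, but the two end properties of \<open>c\<close> make it isolated there.\<close>
  have "\<exists>z \<in> {x. E b x \<and> E c x}. (z \<noteq> v \<and> E u z) \<or> (z \<noteq> u \<and> E v z)"
    by (rule no_isolated) (use uv adj' E in simp_all)
  then show False using c_end_u c_end_v by blast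
qed

lemma induces_P4_if_digraph_iso_path_graph:
  assumes "wf_digraph G" "digraph_iso (G \<restriction> S) (path_graph 4)"
  shows "induces_P4 (dominates G) S"
proof -
  let ?P = "path_graph 4"
  have wf: "wf_digraph (G \<restriction> S)"
    using assms(1) by (rule wf_digraph.wellformed_induce_subgraph)
  have wfP: "wf_digraph ?P"
    using graph_path_graph[of 4] by (simp add: graph_def digraph_def fin_digraph_def)
  \<comment> \<open>The isomorphism is reversed to start at the path, so that the images of 0, 1, 2,
    3 are the witnesses in order.\<close>
  obtain h where h: "pre_digraph.digraph_isomorphism ?P h" "G \<restriction> S = app_iso h ?P"
    using digraph_iso_swap[OF wf assms(2)] unfolding digraph_iso_def by blast
  let ?f = "iso_verts h"
  have verts_P: "verts ?P = {0, 1, 2, 3}"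
    by (auto simp: path_graph_def)
  have inj: "inj_on ?f {0, 1, 2, 3}"
    using pre_digraph.digraph_isomorphism_inj_on_verts[OF h(1)] verts_P by simp
  have S: "S = {?f 0, ?f 1, ?f 2, ?f 3}"
    using arg_cong[OF h(2), of verts] verts_P by simp
  have adj: "?f i \<rightarrow>\<^bsub>G\<^esub> ?f j \<longleftrightarrow> j = Suc i \<or> i = Suc j"
    if "i \<in> {0, 1, 2, 3}" "j \<in> {0, 1, 2, 3}" for i j
  proof -
    have "?f i \<rightarrow>\<^bsub>G\<^esub> ?f j \<longleftrightarrow> ?f i \<rightarrow>\<^bsub>G \<restriction> S\<^esub> ?f j"
      using that S by (auto simp: arcs_ends_conv)
    also have "\<dots> \<longleftrightarrow> i \<rightarrow>\<^bsub>?P\<^esub> j"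
    proof -
      let ?V = "verts ?P"
      have inj_pair: "inj_on (\<lambda>(u, v). (?f u, ?f v)) (?V \<times> ?V)"
        using map_prod_inj_on[OF inj inj] unfolding map_prod_def verts_P .
      have ij: "(i, j) \<in> ?V \<times> ?V" using that unfolding verts_P by blast
      \<comment> \<open>Adjacency can be pulled back through \<open>h\<close> because all adjacent
        pairs lie where the map on pairs is injective.\<close>
      have "arcs_ends ?P \<subseteq> ?V \<times> ?V"
        by (intro subrelI SigmaI) (fact wf_digraph.adj_in_verts[OF wfP])+
      from inj_on_image_mem_iff[OF inj_pair ij this] show ?thesis
        unfolding h(2) wf_digraph.arcs_ends_app_iso_eq[OF wfP h(1)] prod.case .
    qed
    also have "\<dots> \<longleftrightarrow> j = Suc i \<or> i = Suc j"
    proof -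
      have "i < 4" "j < 4" using that by auto
      then show ?thesis by (simp add: path_graph_def)
    qed
    finally show ?thesis .
  qed
  have "distinct [?f 0, ?f 1, ?f 2, ?f 3]"
    using inj by (simp add: inj_on_def)
  then show ?thesis
    unfolding induces_P4_def using S adj
    by (intro exI[of _ "?f 0"] exI[of _ "?f 1"] exI[of _ "?f 2"] exI[of _ "?f 3"]) simp
qed

text \<open>An edgeless graph has every uniform structure vacuously, so an arc is required; the
  argument shows that a shared \<open>P_4\<close> would leave none.\<close>

theorem theorem3:
  fixes G :: "('a,'b) pre_digraph" and H :: "('c,'d) pre_digraph" and n d :: nat
  assumes "G \<in> ER n d 4"
    and "arcs G \<noteq> {}"
    and "uniform_shared_nbhd G H"
  shows "\<not> digraph_iso H (path_graph 4)"
proof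
  assume iso: "digraph_iso H (path_graph 4)"
  interpret graph G using assms(1) by (simp add: ER_def)
  have sym: "symp (dominates G)"
    using sym_arcs by (auto simp: symmetric_def sym_def symp_def)
  have irr: "irreflp (dominates G)"
    by (auto simp: irreflp_def dest: adj_not_same)
  have "induces_P4 (dominates G) {x. u \<rightarrow>\<^bsub>G\<^esub> x \<and> v \<rightarrow>\<^bsub>G\<^esub> x}" if "u \<rightarrow>\<^bsub>G\<^esub> v" for u v
  proof (rule induces_P4_if_digraph_iso_path_graph)
    have "open_nbhd G u \<inter> open_nbhd G v = {x. u \<rightarrow>\<^bsub>G\<^esub> x \<and> v \<rightarrow>\<^bsub>G\<^esub> x}"
      by (auto simp: open_nbhd_def)
    then show "digraph_iso (G \<restriction> {x. u \<rightarrow>\<^bsub>G\<^esub> x \<and> v \<rightarrow>\<^bsub>G\<^esub> x}) (path_graph 4)"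
      using assms(3) that digraph_iso_trans[OF _ iso] by (metis uniform_shared_nbhd_def)
  qed (rule wf_digraph_axioms)
  then have "\<not> u \<rightarrow>\<^bsub>G\<^esub> v" for u v
    using no_uniform_shared_P4[OF sym irr] by blast
  then show False using assms(2) by (auto simp: arcs_ends_conv)
qed

end
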